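(* Let $S^2\subset\mathbb{R}^3$ be the unit sphere with the Euclidean metric, and let $Q'$ be a cluster point, as $s\to\infty$, of a family of $5$-point $s$-energy minimizing configurations on $S^2$. Then $Q'$ is isometric to $$Q:=\{\mathrm{e}_1,-\mathrm{e}_1,\mathrm{e}_2,\mathrm{e}_3,-\mathrm{e}_3\},$$ where $\mathrm{e}_1=(1,0,0)$, $\mathrm{e}_2=(0,1,0)$, and $\mathrm{e}_3=(0,0,1)$.
   Context: For $s>0$ and a configuration $\omega_5=\{x_1,\dots,x_5\}\subset S^2$ of $5$ distinct points, the Riesz $s$-energy is $E_s(\omega_5):=\sum_{1\le i\ne j\le 5}|x_i-x_j|^{-s}$ (sum over ordered pairs, $|\cdot|$ the Euclidean norm), and $\mathcal E_s(S^2,5):=\inf\{E_s(\omega_5):\omega_5\subset S^2,\ \#\omega_5=5\}$. A $5$-point configuration $\omega_5\subset S^2$ is $s$-energy minimizing if $E_s(\omega_5)=\mathcal E_s(S^2,5)$. Given a family $\{\omega_5(s)\}_{s>0}$ of $5$-point configurations, $Q'=\{x_1,\dots,x_5\}$ is a cluster point as $s\to\infty$ if there are $s_k\to\infty$ and labelings $\omega_5(s_k)=\{x_1^{(k)},\dots,x_5^{(k)}\}$ with $x_i^{(k)}\to x_i$ for each $i$. Two configurations on $S^2$ are isometric if one is the image of the other under an orthogonal transformation of $\mathbb{R}^3$. *)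

theory Defs
  imports "HOL-Analysis.Analysis"
begin

abbreviation S2 :: "(real^3) set" where
  "S2 \<equiv> sphere 0 1"

definition S2_configuration :: "nat \<Rightarrow> (real^3) set \<Rightarrow> bool" where
  "S2_configuration N \<omega> \<longleftrightarrow> \<omega> \<subseteq> S2 \<and> finite \<omega> \<and> card \<omega> = N"

definition riesz_energy :: "real \<Rightarrow> (real^3) set \<Rightarrow> real" where
  "riesz_energy s \<omega> = (\<Sum>x\<in>\<omega>. \<Sum>y\<in>\<omega> - {x}. norm (x - y) powr (- s))"

definition min_riesz_energy :: "real \<Rightarrow> nat \<Rightarrow> real" where
  "min_riesz_energy s N = Inf {riesz_energy s \<omega> | \<omega>. S2_configuration N \<omega>}"

definition riesz_minimizing :: "real \<Rightarrow> nat \<Rightarrow> (real^3) set \<Rightarrow> bool" where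
  "riesz_minimizing s N \<omega> \<longleftrightarrow>
     S2_configuration N \<omega> \<and> riesz_energy s \<omega> = min_riesz_energy s N"

(* Only the values of the family \<omega> at positive parameters matter. Each x k is a labeling of the
   configuration \<omega> (s k) without repetition; the limit points y i are not required to be distinct. *)
definition cluster_point_at_infinity ::
  "nat \<Rightarrow> (real \<Rightarrow> (real^3) set) \<Rightarrow> (real^3) set \<Rightarrow> bool" where
  "cluster_point_at_infinity N \<omega> Q \<longleftrightarrow>
     (\<exists>(s :: nat \<Rightarrow> real) (x :: nat \<Rightarrow> nat \<Rightarrow> real^3) (y :: nat \<Rightarrow> real^3).
        (\<forall>k. s k > 0) \<and> filterlim s at_top sequentially \<and>
        (\<forall>k. bij_betw (x k) {1..N} (\<omega> (s k))) \<and>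
        Q = y ` {1..N} \<and>
        (\<forall>i\<in>{1..N}. (\<lambda>k. x k i) \<longlonglongrightarrow> y i))"

definition isometric_configurations :: "(real^3) set \<Rightarrow> (real^3) set \<Rightarrow> bool" where
  "isometric_configurations A B \<longleftrightarrow> (\<exists>f. orthogonal_transformation f \<and> f ` A = B)"

definition e1 :: "real^3" where "e1 = vector [1, 0, 0]"
definition e2 :: "real^3" where "e2 = vector [0, 1, 0]"
definition e3 :: "real^3" where "e3 = vector [0, 0, 1]"

end

theory Submission
  imports Defs "HOL-Real_Asymp.Real_Asymp"
begin

text \<open>Lowering the base of the square pyramid slightly shows that the minimal energy is at most
  \<open>2 * 2 powr (- s / 2) * (4 + o(1))\<close>. Hence the points of a cluster point have pairwise
  nonpositive inner products, which in dimension three forces an antipodal pair \<open>\<plusminus>p\<close> and three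
  points \<open>a\<close>, \<open>b\<close>, \<open>c\<close> on the equator. If two of these are antipodal, the third is orthogonal to them
  and the configuration is \<open>Q\<close>. Otherwise \<open>a\<close>, \<open>b\<close>, \<open>c\<close> have a linear dependency with positive
  weights, each less than half of the total. The nearby minimizers have a perturbed version of this
  dependency for which the weighted sum of the six inner products between poles and equator
  vanishes exactly, so convexity bounds the rescaled energy of these six pairs below by a constant
  greater than \<open>4\<close>, a contradiction.\<close>

section \<open>Scalar triple products and their identities\<close>

definition triple :: "real^3 \<Rightarrow> real^3 \<Rightarrow> real^3 \<Rightarrow> real" where
  "triple x y z = x \<bullet> cross3 y z"

lemmas triple_coords = triple_def cross3_def inner_vec_def sum_3 vector_3

text \<open>A product of two determinants is the determinant of the mutual inner products; the
  right-hand side is the latter, with rows \<open>p\<close>, \<open>r\<close>, \<open>x\<close> and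
  columns \<open>p\<close>, \<open>r\<close>, \<open>y\<close>, expanded along the first
  row.\<close>

lemma triple_mult_triple:
  "triple p r x * triple p r y =
     (p \<bullet> p) * ((r \<bullet> r) * (x \<bullet> y) - (r \<bullet> y) * (r \<bullet> x))
   - (p \<bullet> r) * ((p \<bullet> r) * (x \<bullet> y) - (r \<bullet> y) * (p \<bullet> x))
   + (p \<bullet> y) * ((p \<bullet> r) * (r \<bullet> x) - (r \<bullet> r) * (p \<bullet> x))"
  by (simp add: triple_coords) algebra

text \<open>Cramer's rule with the denominators cleared; for linearly dependent \<open>a\<close>,
  \<open>b\<close>, \<open>c\<close> it becomes a dependency among them.\<close>

lemma triple_expansion:
  "triple p b c *\<^sub>R a + triple p c a *\<^sub>R b + triple p a b *\<^sub>R c = triple a b c *\<^sub>R p"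
  by (simp add: vec_eq_iff forall_3 triple_coords) algebra

lemma triple_rotate: "triple x y z = triple y z x"
  by (simp add: triple_coords algebra_simps)

lemma triple_tendsto [tendsto_intros]:
  assumes "(f \<longlongrightarrow> x) F" "(g \<longlongrightarrow> y) F" "(h \<longlongrightarrow> z) F"
  shows "((\<lambda>k. triple (f k) (g k) (h k)) \<longlongrightarrow> triple x y z) F"
  unfolding triple_def
  by (intro tendsto_inner assms bounded_bilinear.tendsto[OF bilinear_conv_bounded_bilinear[THEN iffD1, OF bilinear_cross]])

section \<open>Antipodal pairs among unit vectors with nonpositive inner products\<close>

lemma unit_inner_eq_minus_one:
  fixes x y :: "'a::real_inner"
  assumes "norm x = 1" "norm y = 1" "x \<bullet> y = - 1"
  shows "y = - x"
proof -
  have "(x + y) \<bullet> (x + y) = 0"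
    using assms by (simp add: inner_add_left inner_add_right inner_commute norm_eq_1)
  then show ?thesis by (simp add: add_eq_0_iff)
qed

lemma unit_inner_ge_minus_one:
  fixes x y :: "'a::real_inner"
  assumes "norm x = 1" "norm y = 1"
  shows "- 1 \<le> x \<bullet> y"
  using Cauchy_Schwarz_ineq2[of x y] assms by simp

text \<open>In the Gram expansion every term without \<open>x \<bullet> y\<close> is nonpositive
  under these sign conditions. Hence \<open>x\<close> and \<open>y\<close> never lie strictly on the
  same side of a plane through the origin, \<open>p\<close> and \<open>r\<close>.\<close>

lemma triple_mult_triple_nonpos:
  assumes "norm p = 1" "norm r = 1" "norm x = 1" "norm y = 1"
    and "p \<bullet> r \<le> 0" "p \<bullet> x \<le> 0" "p \<bullet> y \<le> 0" "r \<bullet> x \<le> 0" "r \<bullet> y \<le> 0" "x \<bullet> y \<le> 0"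
  shows "triple p r x * triple p r y \<le> (1 - (p \<bullet> r)\<^sup>2) * (x \<bullet> y)"
proof -
  have "triple p r x * triple p r y = (1 - (p \<bullet> r)\<^sup>2) * (x \<bullet> y)
      - (r \<bullet> y) * (r \<bullet> x) + (p \<bullet> r) * ((r \<bullet> y) * (p \<bullet> x)) + (p \<bullet> r) * ((p \<bullet> y) * (r \<bullet> x))
      - (p \<bullet> y) * (p \<bullet> x)"
    using assms(1-4) unfolding triple_mult_triple norm_eq_1
    by (simp add: power2_eq_square algebra_simps)
  moreover have "(r \<bullet> y) * (r \<bullet> x) \<ge> 0" "(p \<bullet> y) * (p \<bullet> x) \<ge> 0" "(r \<bullet> y) * (p \<bullet> x) \<ge> 0"
    "(p \<bullet> y) * (r \<bullet> x) \<ge> 0" using assms by (auto intro: mult_nonpos_nonpos)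
  moreover from this have "(p \<bullet> r) * ((r \<bullet> y) * (p \<bullet> x)) \<le> 0" "(p \<bullet> r) * ((p \<bullet> y) * (r \<bullet> x)) \<le> 0"
    using assms by (auto intro: mult_nonpos_nonneg)
  ultimately show ?thesis by linarith
qed

lemma inner_zero_of_triple_zero:
  assumes "norm p = 1" "norm r = 1" "norm x = 1" "norm y = 1"
    and "p \<bullet> r \<le> 0" "p \<bullet> x \<le> 0" "p \<bullet> y \<le> 0" "r \<bullet> x \<le> 0" "r \<bullet> y \<le> 0" "x \<bullet> y \<le> 0"
    and "p \<bullet> r \<noteq> - 1" "triple p r x = 0"
  shows "x \<bullet> y = 0"
proof -
  have "0 \<le> (1 - (p \<bullet> r)\<^sup>2) * (x \<bullet> y)"
    using triple_mult_triple_nonpos[OF assms(1-10)] assms(12) by simp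
  moreover have "1 - (p \<bullet> r)\<^sup>2 > 0"
    using unit_inner_ge_minus_one[OF assms(1,2)] assms(5,11)
    by (auto simp: power2_eq_square abs_square_less_1[unfolded power2_eq_square])
  ultimately show ?thesis using assms(10) by (simp add: zero_le_mult_iff)
qed

text \<open>Without an antipodal pair in the coplanar triple, \<open>y\<close> and \<open>z\<close>
  are both orthogonal to its plane. Unit vectors on that normal line agree up to sign, and
  nonpositivity leaves only the opposite ones.\<close>

lemma antipodal_of_coplanar:
  assumes unit: "norm p = 1" "norm r = 1" "norm x = 1" "norm y = 1" "norm z = 1"
    and np: "p \<bullet> r \<le> 0" "p \<bullet> x \<le> 0" "p \<bullet> y \<le> 0" "p \<bullet> z \<le> 0"
      "r \<bullet> x \<le> 0" "r \<bullet> y \<le> 0" "r \<bullet> z \<le> 0" "x \<bullet> y \<le> 0" "x \<bullet> z \<le> 0" "y \<bullet> z \<le> 0"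
    and cop: "triple p r x = 0"
  shows "p \<bullet> r = - 1 \<or> p \<bullet> x = - 1 \<or> r \<bullet> x = - 1 \<or> y \<bullet> z = - 1"
proof (rule ccontr)
  assume *: "\<not> ?thesis"
  have c2: "triple r x p = 0" "triple x p r = 0" using cop triple_rotate by metis+
  have z: "x \<bullet> y = 0" "x \<bullet> z = 0" "p \<bullet> y = 0" "p \<bullet> z = 0" "r \<bullet> y = 0" "r \<bullet> z = 0"
    using inner_zero_of_triple_zero[of p r x y] inner_zero_of_triple_zero[of p r x z]
      inner_zero_of_triple_zero[of r x p y] inner_zero_of_triple_zero[of r x p z]
      inner_zero_of_triple_zero[of x p r y] inner_zero_of_triple_zero[of x p r z]
      assms * c2 by (simp_all add: inner_commute)
  have pr: "1 - (p \<bullet> r)\<^sup>2 > 0"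
    using unit_inner_ge_minus_one[OF unit(1,2)] np(1) *
    by (auto simp: power2_eq_square abs_square_less_1[unfolded power2_eq_square])
  \<comment> \<open>Comparing the product of the two squares with the square of the mixed product
    forces \<open>y \<bullet> z\<close> to be \<open>1\<close> or \<open>- 1\<close>.\<close>
  have "triple p r y * triple p r y = 1 - (p \<bullet> r)\<^sup>2" "triple p r z * triple p r z = 1 - (p \<bullet> r)\<^sup>2"
    "triple p r y * triple p r z = (1 - (p \<bullet> r)\<^sup>2) * (y \<bullet> z)"
    using z unit unfolding triple_mult_triple norm_eq_1
    by (simp_all add: power2_eq_square algebra_simps)
  then have "(1 - (p \<bullet> r)\<^sup>2)\<^sup>2 * ((y \<bullet> z)\<^sup>2 - 1) = 0" by algebra
  then have "(y \<bullet> z)\<^sup>2 = 1" using pr by auto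
  then show False using * np by (auto simp: power2_eq_1_iff)
qed

lemma exists_antipodal_pair:
  fixes y :: "nat \<Rightarrow> real^3"
  assumes unit: "\<And>i. i \<in> {1..5} \<Longrightarrow> norm (y i) = 1"
    and np: "\<And>i j. i \<in> {1..5} \<Longrightarrow> j \<in> {1..5} \<Longrightarrow> i \<noteq> j \<Longrightarrow> y i \<bullet> y j \<le> 0"
  shows "\<exists>i\<in>{1..5}. \<exists>j\<in>{1..5}. i \<noteq> j \<and> y j = - y i"
proof -
  let ?t = "\<lambda>i. triple (y 1) (y 2) (y i)"
  have sgn: "?t i * ?t j \<le> 0" if "i \<in> {3,4,5}" "j \<in> {3,4,5}" "i \<noteq> j" for i j
  proof -
    have "?t i * ?t j \<le> (1 - (y 1 \<bullet> y 2)\<^sup>2) * (y i \<bullet> y j)"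
      using that by (intro triple_mult_triple_nonpos unit np) auto
    also have "\<dots> \<le> 0"
      using that np[of i j] np[of 1 2] unit_inner_ge_minus_one[OF unit unit, of 1 2]
      by (intro mult_nonneg_nonpos) (auto simp: abs_square_le_1)
    finally show ?thesis .
  qed
  \<comment> \<open>Of three nonzero reals two share a sign, so their product would be
    positive.\<close>
  have zero: "?t 3 = 0 \<or> ?t 4 = 0 \<or> ?t 5 = 0"
    using sgn[of 3 4] sgn[of 3 5] sgn[of 4 5] by (auto simp: mult_le_0_iff)
  have pair: ?thesis if "y i \<bullet> y j = - 1" "i \<in> {1..5}" "j \<in> {1..5}" "i \<noteq> j" for i j
    using that unit_inner_eq_minus_one[OF unit unit] by blast
  have split: ?thesis if "triple (y i) (y j) (y k) = 0" "distinct [i, j, k, l, m]"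
      "i \<in> {1..5}" "j \<in> {1..5}" "k \<in> {1..5}" "l \<in> {1..5}" "m \<in> {1..5}" for i j k l m
  proof -
    have "y i \<bullet> y j = - 1 \<or> y i \<bullet> y k = - 1 \<or> y j \<bullet> y k = - 1 \<or> y l \<bullet> y m = - 1"
      by (rule antipodal_of_coplanar) (use that unit np in auto)
    then show ?thesis by (elim disjE) (erule pair; use that in simp)+
  qed
  have ?thesis if "?t 3 = 0" by (rule split[OF that, of 4 5]) simp_all
  moreover have ?thesis if "?t 4 = 0" by (rule split[OF that, of 3 5]) simp_all
  moreover have ?thesis if "?t 5 = 0" by (rule split[OF that, of 3 4]) simp_all
  ultimately show ?thesis using zero by blast
qed

section \<open>Rescaled Riesz energy and upper bounds for its minimum\<close>

lemma norm_diff_powr_unit: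
  fixes x y :: "'a::real_inner"
  assumes "norm x = 1" "norm y = 1"
  shows "norm (x - y) powr (- s) = 2 powr (- s / 2) * (1 - x \<bullet> y) powr (- s / 2)"
proof -
  have sq: "(norm (x - y))\<^sup>2 = 2 * (1 - x \<bullet> y)"
    using assms unfolding power2_norm_eq_inner norm_eq_1
    by (simp add: inner_diff_left inner_diff_right inner_commute)
  have le: "x \<bullet> y \<le> 1" using Cauchy_Schwarz_ineq2[of x y] assms by simp
  have "norm (x - y) = (2 * (1 - x \<bullet> y)) powr (1/2)"
    using sq le by (metis norm_ge_zero powr_half_sqrt real_sqrt_unique zero_le_power2)
  then have "norm (x - y) powr (- s) = (2 * (1 - x \<bullet> y)) powr (- s / 2)"
    by (simp add: powr_powr)
  also have "\<dots> = 2 powr (- s / 2) * (1 - x \<bullet> y) powr (- s / 2)"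
    by (rule powr_mult)
  finally show ?thesis .
qed

text \<open>Half of the energy, rescaled by \<open>2 powr (s/2)\<close> so that pairs at the packing distance
  \<open>sqrt 2\<close> contribute \<open>1\<close>.\<close>

definition pair_energy :: "real \<Rightarrow> real^3 \<Rightarrow> real^3 \<Rightarrow> real" where
  "pair_energy s x y = (1 - x \<bullet> y) powr (- s / 2)"

lemma pair_energy_nonneg: "0 \<le> pair_energy s x y"
  by (simp add: pair_energy_def)

text \<open>The leading \<open>2\<close> counts ordered pairs. The six pairs between the future
  poles \<open>p\<close>, \<open>q\<close> and the future equator \<open>a\<close>,
  \<open>b\<close>, \<open>c\<close> come first.\<close>

lemma riesz_energy_five:
  assumes "norm p = 1" "norm q = 1" "norm a = 1" "norm b = 1" "norm c = 1"
    and "distinct [p, q, a, b, c]"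
  shows "riesz_energy s {p, q, a, b, c} = 2 * 2 powr (- s / 2) *
    (pair_energy s p a + pair_energy s p b + pair_energy s p c +
     pair_energy s q a + pair_energy s q b + pair_energy s q c +
     pair_energy s a b + pair_energy s b c + pair_energy s c a + pair_energy s p q)"
proof -
  have d: "p \<noteq> q" "p \<noteq> a" "p \<noteq> b" "p \<noteq> c" "q \<noteq> a" "q \<noteq> b" "q \<noteq> c" "a \<noteq> b" "a \<noteq> c" "b \<noteq> c"
    using assms(6) by auto
  have rm: "{p,q,a,b,c} - {p} = {q,a,b,c}" "{p,q,a,b,c} - {q} = {p,a,b,c}"
    "{p,q,a,b,c} - {a} = {p,q,b,c}" "{p,q,a,b,c} - {b} = {p,q,a,c}" "{p,q,a,b,c} - {c} = {p,q,a,b}"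
    using d by auto
  define n where "n x y = norm (x - y) powr (- s)" for x y :: "real^3"
  have n: "n x y = 2 powr (- s / 2) * pair_energy s x y" if "norm x = 1" "norm y = 1" for x y
    using norm_diff_powr_unit that by (simp add: n_def pair_energy_def)
  have "riesz_energy s {p, q, a, b, c} = (\<Sum>x\<in>{p,q,a,b,c}. \<Sum>y\<in>{p,q,a,b,c} - {x}. n x y)"
    by (simp add: riesz_energy_def n_def)
  also have "\<dots> = (n p q + n p a + n p b + n p c) + (n q p + n q a + n q b + n q c)
      + (n a p + n a q + n a b + n a c) + (n b p + n b q + n b a + n b c)
      + (n c p + n c q + n c a + n c b)"
    using d d[symmetric] by (simp add: rm)
  also have "\<dots> = 2 * (n p a + n p b + n p c + n q a + n q b + n q c + n a b + n b c + n c a + n p q)"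
    by (simp add: n_def norm_minus_commute)
  finally show ?thesis using assms by (simp add: n algebra_simps)
qed

lemma min_riesz_energy_le:
  assumes "S2_configuration N \<omega>"
  shows "min_riesz_energy s N \<le> riesz_energy s \<omega>"
  unfolding min_riesz_energy_def
proof (rule cInf_lower)
  show "riesz_energy s \<omega> \<in> {riesz_energy s \<omega> |\<omega>. S2_configuration N \<omega>}" using assms by blast
  show "bdd_below {riesz_energy s \<omega> |\<omega>. S2_configuration N \<omega>}"
    by (rule bdd_belowI[of _ 0]) (auto simp: riesz_energy_def intro!: sum_nonneg)
qed

text \<open>The competitor is the pyramid with apex \<open>e2\<close> and square base at height
  \<open>- h\<close>; the three terms come from the four apex edges, the four base sides and the two
  base diagonals.\<close>

lemma min_riesz_energy_pyramid:
  assumes "0 < h" "h < 1"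
  shows "min_riesz_energy s 5 \<le> 2 * 2 powr (- s / 2) *
    (4 * (1 + h) powr (- s / 2) + 4 * (1 - h\<^sup>2) powr (- s / 2) + 2 * (2 - 2 * h\<^sup>2) powr (- s / 2))"
proof -
  define r where "r = sqrt (1 - h\<^sup>2)"
  have h2: "h\<^sup>2 < 1" using assms by (simp add: power_less_one_iff)
  have r: "0 < r" "r * r = 1 - h\<^sup>2" using h2 by (auto simp: r_def)
  define u1 u2 u3 u4 :: "real^3" where
    "u1 = vector [r, - h, 0]" and "u2 = vector [- r, - h, 0]" and
    "u3 = vector [0, - h, r]" and "u4 = vector [0, - h, - r]"
  note us = u1_def u2_def u3_def u4_def e2_def
  have unit: "norm e2 = 1" "norm u1 = 1" "norm u2 = 1" "norm u3 = 1" "norm u4 = 1"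
    using r by (simp_all add: us norm_eq_1 inner_vec_def sum_3 power2_eq_square)
  have dist: "distinct [u1, u2, u3, u4, e2]"
    using r assms by (auto simp: us vec_eq_iff forall_3)
  have "S2_configuration 5 {u1, u2, u3, u4, e2}"
    using unit dist by (auto simp: S2_configuration_def)
  then have "min_riesz_energy s 5 \<le> riesz_energy s {u1, u2, u3, u4, e2}"
    by (rule min_riesz_energy_le)
  also have "\<dots> = 2 * 2 powr (- s / 2) *
    (4 * (1 + h) powr (- s / 2) + 4 * (1 - h\<^sup>2) powr (- s / 2) + 2 * (2 - 2 * h\<^sup>2) powr (- s / 2))"
  proof -
    have "u1 \<bullet> u3 = h\<^sup>2" "u1 \<bullet> u4 = h\<^sup>2" "u2 \<bullet> u3 = h\<^sup>2" "u2 \<bullet> u4 = h\<^sup>2"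
      "u1 \<bullet> e2 = - h" "u2 \<bullet> e2 = - h" "u3 \<bullet> e2 = - h" "u4 \<bullet> e2 = - h"
      "e2 \<bullet> u1 = - h" "e2 \<bullet> u2 = - h" "e2 \<bullet> u3 = - h" "e2 \<bullet> u4 = - h"
      "u1 \<bullet> u2 = 2 * h\<^sup>2 - 1" "u3 \<bullet> u4 = 2 * h\<^sup>2 - 1"
      using r by (simp_all add: us inner_vec_def sum_3 power2_eq_square algebra_simps)
    then show ?thesis
      using unit dist by (subst riesz_energy_five) (simp_all add: pair_energy_def)
  qed
  finally show ?thesis .
qed

text \<open>Lowering the base by \<open>h = s powr (-3/4)\<close> makes \<open>s h\<close> large and \<open>s h\<^sup>2\<close> small: the four
  contacts with the apex disappear in the limit, and the four base contacts still cost \<open>1\<close> each.\<close>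

lemma min_riesz_energy_eventually_le:
  assumes "C > 4"
  shows "eventually (\<lambda>s. min_riesz_energy s 5 \<le> 2 * 2 powr (- s / 2) * C) at_top"
proof -
  let ?h = "\<lambda>s::real. s powr (-3/4)"
  let ?F = "\<lambda>s. 4 * (1 + ?h s) powr (- s / 2) + 4 * (1 - (?h s)\<^sup>2) powr (- s / 2)
      + 2 * (2 - 2 * (?h s)\<^sup>2) powr (- s / 2)"
  have "(?F \<longlongrightarrow> 4) at_top" by real_asymp
  then have "eventually (\<lambda>s. ?F s < C) at_top" using assms by (rule order_tendstoD)
  moreover have "eventually (\<lambda>s::real. s > 1) at_top" by (rule eventually_gt_at_top)
  ultimately show ?thesis
  proof eventually_elim
    case (elim s)
    have "0 < ?h s" "?h s < 1" using elim by (auto simp: powr_less_one)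
    then have "min_riesz_energy s 5 \<le> 2 * 2 powr (- s / 2) * ?F s" by (rule min_riesz_energy_pyramid)
    also have "\<dots> \<le> 2 * 2 powr (- s / 2) * C" using elim by (intro mult_left_mono) auto
    finally show ?case .
  qed
qed

section \<open>Lower bounds for the energy\<close>

text \<open>With \<open>t = x \<bullet> y\<close>, combine \<open>ln (1 - t) \<le> - t\<close> with
  \<open>exp u \<ge> 1 + u\<close>. A bound linear in the inner product allows first-order terms to
  cancel in weighted sums.\<close>

lemma pair_energy_ge:
  assumes "norm x = 1" "norm y = 1" "x \<noteq> y" "s > 0"
  shows "1 + s / 2 * (x \<bullet> y) \<le> pair_energy s x y"
proof -
  \<comment> \<open>Coinciding points must be excluded: \<open>0 powr _\<close> is \<open>0\<close>,
    so the bound would fail there.\<close>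
  have "x \<bullet> y \<noteq> 1" using assms
    by (metis inner_minus_right minus_minus norm_minus_cancel unit_inner_eq_minus_one)
  moreover have "x \<bullet> y \<le> 1" using Cauchy_Schwarz_ineq2[of x y] assms by simp
  ultimately have lt: "x \<bullet> y < 1" by simp
  then have "ln (1 - x \<bullet> y) \<le> - (x \<bullet> y)" using ln_le_minus_one[of "1 - x \<bullet> y"] by simp
  then have "s / 2 * ln (1 - x \<bullet> y) \<le> s / 2 * (- (x \<bullet> y))" using assms by (intro mult_left_mono) auto
  then have "s / 2 * (x \<bullet> y) \<le> - s / 2 * ln (1 - x \<bullet> y)" by simp
  then have "exp (s / 2 * (x \<bullet> y)) \<le> pair_energy s x y" using lt by (simp add: pair_energy_def powr_def)
  then show ?thesis using exp_ge_add_one_self[of "s / 2 * (x \<bullet> y)"] by linarith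
qed

text \<open>The weights \<open>\<lambda> * triple p b c\<close>, \<open>\<dots>\<close> annihilate the first-order terms exactly: the
  \<open>triple_expansion\<close> of \<open>p\<close> is orthogonal to \<open>q - (p \<bullet> q) p\<close>.\<close>

lemma bipyramid_energy_ge:
  fixes \<sigma> \<theta> :: real
  assumes unit: "norm p = 1" "norm q = 1" "norm a = 1" "norm b = 1" "norm c = 1"
    and dist: "distinct [p, q, a, b, c]" and s: "s > 0"
    and pq: "p \<bullet> q \<le> 0"
    and w: "0 \<le> \<sigma> * triple p b c" "0 \<le> \<sigma> * triple p c a" "0 \<le> \<sigma> * triple p a b"
      "\<sigma> * triple p b c \<le> \<theta>" "\<sigma> * triple p c a \<le> \<theta>" "\<sigma> * triple p a b \<le> \<theta>"
  shows "(1 - p \<bullet> q) * (\<sigma> * triple p b c + \<sigma> * triple p c a + \<sigma> * triple p a b) \<le>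
    \<theta> * (pair_energy s p a + pair_energy s p b + pair_energy s p c +
     pair_energy s q a + pair_energy s q b + pair_energy s q c)"
proof -
  define A B C l where "A = \<sigma> * triple p b c" and "B = \<sigma> * triple p c a" and "C = \<sigma> * triple p a b"
    and "l = - (p \<bullet> q)"
  have l: "0 \<le> l" "l \<le> 1"
    using pq unit_inner_ge_minus_one[OF unit(1,2)] by (auto simp: l_def)
  have np: "p \<bullet> p = 1" using unit by (simp add: norm_eq_1)
  have "(q + l *\<^sub>R p) \<bullet> (triple p b c *\<^sub>R a + triple p c a *\<^sub>R b + triple p a b *\<^sub>R c) = 0"
    unfolding triple_expansion by (simp add: inner_add_left inner_diff_right l_def np inner_commute)
  then have zero: "l * A * (p \<bullet> a) + l * B * (p \<bullet> b) + l * C * (p \<bullet> c)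
      + A * (q \<bullet> a) + B * (q \<bullet> b) + C * (q \<bullet> c) = 0"
    unfolding A_def B_def C_def inner_add_left inner_add_right by (simp) algebra
  have weighted: "m * (1 + s / 2 * (x \<bullet> y)) \<le> \<theta> * pair_energy s x y"
    if "norm x = 1" "norm y = 1" "x \<noteq> y" "0 \<le> m" "m \<le> \<theta>" for m x y
  proof -
    have "m * (1 + s / 2 * (x \<bullet> y)) \<le> m * pair_energy s x y"
      using pair_energy_ge[OF that(1-3) s] that by (intro mult_left_mono)
    also have "\<dots> \<le> \<theta> * pair_energy s x y"
      using that pair_energy_nonneg by (intro mult_right_mono)
    finally show ?thesis .
  qed
  have lm: "0 \<le> l * m" "l * m \<le> \<theta>" if "0 \<le> m" "m \<le> \<theta>" for m
    using l that mult_left_le_one_le[of m l] by auto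
  have ne: "p \<noteq> a" "p \<noteq> b" "p \<noteq> c" "q \<noteq> a" "q \<noteq> b" "q \<noteq> c" using dist by auto
  note w' = w[folded A_def B_def C_def]
  \<comment> \<open>The pairs at \<open>p\<close> carry the weights \<open>l * A\<close>,
    \<open>l * B\<close>, \<open>l * C\<close>, those at \<open>q\<close> the weights
    \<open>A\<close>, \<open>B\<close>, \<open>C\<close>. The bracket subtracted last vanishes by
    \<open>zero\<close>, so only the constant terms survive.\<close>
  have "(1 + l) * (A + B + C) =
      l * A * (1 + s / 2 * (p \<bullet> a)) + l * B * (1 + s / 2 * (p \<bullet> b)) + l * C * (1 + s / 2 * (p \<bullet> c))
      + A * (1 + s / 2 * (q \<bullet> a)) + B * (1 + s / 2 * (q \<bullet> b)) + C * (1 + s / 2 * (q \<bullet> c))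
      - s / 2 * (l * A * (p \<bullet> a) + l * B * (p \<bullet> b) + l * C * (p \<bullet> c)
      + A * (q \<bullet> a) + B * (q \<bullet> b) + C * (q \<bullet> c))"
    by (simp add: algebra_simps)
  also have "\<dots> \<le> \<theta> * pair_energy s p a + \<theta> * pair_energy s p b + \<theta> * pair_energy s p c
      + \<theta> * pair_energy s q a + \<theta> * pair_energy s q b + \<theta> * pair_energy s q c"
    unfolding zero mult_zero_right diff_0_right
    by (intro add_mono weighted lm w' unit ne)
  finally have "(1 + l) * (A + B + C) \<le> \<theta> * (pair_energy s p a + pair_energy s p b
      + pair_energy s p c + pair_energy s q a + pair_energy s q b + pair_energy s q c)"
    by (simp only: distrib_left)
  then show ?thesis unfolding A_def B_def C_def l_def by simp
qed

section \<open>Plane geometry of the equator, and recognition of the pyramid\<close>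

text \<open>The triple products are the coefficients of a linear dependency of \<open>a\<close>,
  \<open>b\<close>, \<open>c\<close>. Nonpositive inner products give them a common sign, which
  \<open>\<sigma>\<close> normalizes. The strict triangle inequalities make each weight less than
  half of the total, which later lifts the energy bound above \<open>4\<close>.\<close>

lemma equator_triples:
  assumes unit: "norm p = 1" "norm a = 1" "norm b = 1" "norm c = 1"
    and perp: "p \<bullet> a = 0" "p \<bullet> b = 0" "p \<bullet> c = 0"
    and np: "a \<bullet> b \<le> 0" "b \<bullet> c \<le> 0" "c \<bullet> a \<le> 0"
    and nanti: "b \<noteq> - a" "c \<noteq> - b" "a \<noteq> - c"
  obtains \<sigma> :: real where "0 < \<sigma> * triple p b c" "0 < \<sigma> * triple p c a" "0 < \<sigma> * triple p a b"
    "\<sigma> * triple p b c < \<sigma> * triple p c a + \<sigma> * triple p a b"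
    "\<sigma> * triple p c a < \<sigma> * triple p b c + \<sigma> * triple p a b"
    "\<sigma> * triple p a b < \<sigma> * triple p b c + \<sigma> * triple p c a"
proof -
  define A B C where "A = triple p b c" and "B = triple p c a" and "C = triple p a b"
  have n1: "p \<bullet> p = 1" "a \<bullet> a = 1" "b \<bullet> b = 1" "c \<bullet> c = 1" using unit by (simp_all add: norm_eq_1)
  have nz: "triple p x y \<noteq> 0" if "norm x = 1" "norm y = 1" "p \<bullet> x = 0" "p \<bullet> y = 0" "x \<bullet> y \<le> 0" "y \<noteq> - x" for x y
  proof
    assume "triple p x y = 0"
    then have "(x \<bullet> y)\<^sup>2 = 1"
      using triple_mult_triple[of p x y y] that n1
      by (simp add: norm_eq_1 power2_eq_square inner_commute)
    then show False using that unit_inner_eq_minus_one[of x y] by (auto simp: power2_eq_1_iff)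
  qed
  have nz': "A \<noteq> 0" "B \<noteq> 0" "C \<noteq> 0"
    using nz[of b c] nz[of c a] nz[of a b] assms by (auto simp: A_def B_def C_def)
  have dep: "A *\<^sub>R a + B *\<^sub>R b + C *\<^sub>R c = 0"
  proof -
    \<comment> \<open>The combination is a multiple of \<open>p\<close> by Cramer's rule, yet
      orthogonal to \<open>p\<close>.\<close>
    have "p \<bullet> (A *\<^sub>R a + B *\<^sub>R b + C *\<^sub>R c) = triple a b c"
      unfolding A_def B_def C_def triple_expansion using n1 by simp
    then have "triple a b c = 0" using perp by (simp add: inner_add_right)
    then show ?thesis using triple_expansion[of p b c a] by (simp add: A_def B_def C_def)
  qed
  have eq: "A + B * (a \<bullet> b) + C * (c \<bullet> a) = 0" "B + A * (a \<bullet> b) + C * (b \<bullet> c) = 0"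
    "C + A * (c \<bullet> a) + B * (b \<bullet> c) = 0"
    using arg_cong[OF dep, of "\<lambda>v. a \<bullet> v"] arg_cong[OF dep, of "\<lambda>v. b \<bullet> v"] arg_cong[OF dep, of "\<lambda>v. c \<bullet> v"] n1
    by (simp_all add: inner_add_right inner_commute)
  then have eq': "A + C * (c \<bullet> a) + B * (a \<bullet> b) = 0" "B + C * (b \<bullet> c) + A * (a \<bullet> b) = 0"
    "C + B * (b \<bullet> c) + A * (c \<bullet> a) = 0"
    by linarith+
  have sign: "x > 0 \<Longrightarrow> y > 0 \<or> z > 0" "x < 0 \<Longrightarrow> y < 0 \<or> z < 0"
    if "x + y * u + z * v = 0" "u \<le> 0" "v \<le> 0" for x y z u v :: real
    using that mult_nonpos_nonpos[of y u] mult_nonpos_nonpos[of z v]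
      mult_nonneg_nonpos[of y u] mult_nonneg_nonpos[of z v] by linarith+
  have "A > 0 \<Longrightarrow> B > 0 \<or> C > 0" "A < 0 \<Longrightarrow> B < 0 \<or> C < 0"
    "B > 0 \<Longrightarrow> A > 0 \<or> C > 0" "B < 0 \<Longrightarrow> A < 0 \<or> C < 0"
    "C > 0 \<Longrightarrow> A > 0 \<or> B > 0" "C < 0 \<Longrightarrow> A < 0 \<or> B < 0"
    using sign[OF eq(1) np(1,3)] sign[OF eq(2) np(1,2)] sign[OF eq(3) np(3,2)] by blast+
  \<comment> \<open>With mixed signs, one of the three nonzero coefficients would be alone with its
    sign.\<close>
  then have same: "(A > 0 \<and> B > 0 \<and> C > 0) \<or> (A < 0 \<and> B < 0 \<and> C < 0)"
    using nz' by (meson linorder_neqE_linordered_idom order_less_asym)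
  define \<sigma> where "\<sigma> = sgn A"
  have pos: "0 < \<sigma> * A" "0 < \<sigma> * B" "0 < \<sigma> * C" using same by (auto simp: \<sigma>_def)
  \<comment> \<open>The mixed term is nonpositive, so
    \<open>x * x \<le> y * y + z * z < (y + z) * (y + z)\<close>.\<close>
  have less: "x < y + z" if "x * x = y * y + z * z + 2 * (y * z) * t" "t \<le> 0" "0 < x" "0 < y" "0 < z"
    for x y z t :: real
  proof (rule ccontr)
    assume "\<not> x < y + z"
    then have "(y + z) * (y + z) \<le> x * x" using that by (intro mult_mono) auto
    moreover have "(y * z) * t \<le> 0" "0 < y * z" using that by (auto simp: mult_nonneg_nonpos)
    ultimately show False using that(1) by (simp add: algebra_simps)
  qed
  \<comment> \<open>A law of cosines: \<open>u\<close> times the first equation minus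
    \<open>v\<close> times the second minus \<open>w\<close> times the third eliminates
    \<open>\<alpha>\<close> and \<open>\<beta>\<close>.\<close>
  have squares: "u * u = v * v + w * w + 2 * (v * w) * \<gamma>"
    if "u + v * \<alpha> + w * \<beta> = 0" "v + u * \<alpha> + w * \<gamma> = 0" "w + u * \<beta> + v * \<gamma> = 0"
    for u v w \<alpha> \<beta> \<gamma> :: real
  proof -
    have "u * u - (v * v + w * w + 2 * (v * w) * \<gamma>) =
        u * (u + v * \<alpha> + w * \<beta>) - v * (v + u * \<alpha> + w * \<gamma>) - w * (w + u * \<beta> + v * \<gamma>)"
      by (simp add: algebra_simps)
    then show ?thesis unfolding that by simp
  qed
  have sq: "A * A = B * B + C * C + 2 * (B * C) * (b \<bullet> c)"
    "B * B = A * A + C * C + 2 * (A * C) * (c \<bullet> a)"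
    "C * C = A * A + B * B + 2 * (A * B) * (a \<bullet> b)"
    using squares[OF eq] squares[OF eq(2,1) eq'(3)] squares[OF eq(3) eq'(1,2)] by blast+
  have \<sigma>: "(\<sigma> * u) * (\<sigma> * v) = u * v" for u v
    using same by (auto simp: \<sigma>_def)
  have "\<sigma> * A < \<sigma> * B + \<sigma> * C" "\<sigma> * B < \<sigma> * A + \<sigma> * C" "\<sigma> * C < \<sigma> * A + \<sigma> * B"
    using less[OF _ np(2) pos(1,2,3)] less[OF _ np(3) pos(2,1,3)] less[OF _ np(1) pos(3,1,2)]
    unfolding \<sigma> using sq by blast+
  then show ?thesis using that[of \<sigma>] pos by (simp add: A_def B_def C_def)
qed

lemma isometric_pyramid:
  assumes "norm p = 1" "norm a = 1" "norm c = 1" "p \<bullet> a = 0" "p \<bullet> c = 0" "a \<bullet> c = 0"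
  shows "isometric_configurations {p, - p, a, - a, c} {e1, - e1, e2, e3, - e3}"
proof -
  define M :: "real^3^3" where "M = vector [p, c, a]"
  have "orthogonal_matrix M"
    using assms unfolding orthogonal_matrix_orthonormal_rows
    by (simp add: M_def forall_3 row_def vec_lambda_eta orthogonal_def inner_commute)
  then have orth: "orthogonal_transformation ((*v) M)"
    by (simp add: orthogonal_transformation_matrix)
  have M: "M *v x = vector [p \<bullet> x, c \<bullet> x, a \<bullet> x]" for x
    by (simp add: vec_eq_iff forall_3 matrix_vector_mul_component M_def)
  have im: "M *v p = e1" "M *v a = e3" "M *v c = e2"
    using assms by (simp_all add: M e1_def e2_def e3_def inner_commute norm_eq_1)
  have "M *v (- x) = - (M *v x)" for x
    using linear_neg[OF matrix_vector_mul_linear] by blast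
  then have "(*v) M ` {p, - p, a, - a, c} = {e1, - e1, e2, e3, - e3}"
    using im by auto
  then show ?thesis using orth unfolding isometric_configurations_def by blast
qed

section \<open>Passage to the limit\<close>

text \<open>Were the limit positive, the tangent bound \<open>1 + s / 2 * (x \<bullet> y)\<close>
  would tend to infinity with \<open>s\<close>, against the bounded pair energy.\<close>

lemma limit_inner_nonpos:
  fixes s :: "nat \<Rightarrow> real"
  assumes s: "filterlim s at_top sequentially"
    and unit: "\<And>k. norm (x k) = 1" "\<And>k. norm (y k) = 1" and ne: "\<And>k. x k \<noteq> y k"
    and lim: "x \<longlonglongrightarrow> u" "y \<longlonglongrightarrow> v"
    and bdd: "eventually (\<lambda>k. pair_energy (s k) (x k) (y k) \<le> C) sequentially"
  shows "u \<bullet> v \<le> 0"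
proof (rule ccontr)
  assume "\<not> ?thesis"
  then have pos: "u \<bullet> v > 0" by simp
  have "(\<lambda>k. x k \<bullet> y k) \<longlonglongrightarrow> u \<bullet> v" by (intro tendsto_inner lim)
  then have "eventually (\<lambda>k. x k \<bullet> y k > u \<bullet> v / 2) sequentially"
    using pos by (intro order_tendstoD) auto
  moreover have "eventually (\<lambda>k. s k > max 0 (4 * C / (u \<bullet> v))) sequentially"
    using s unfolding filterlim_at_top_dense by blast
  ultimately have "eventually (\<lambda>k. False) sequentially" using bdd
  proof eventually_elim
    case (elim k)
    have "C < s k / 2 * (u \<bullet> v / 2)" using elim(2) pos by (simp add: field_simps)
    also have "\<dots> \<le> s k / 2 * (x k \<bullet> y k)" using elim by (intro mult_left_mono) auto
    also have "\<dots> \<le> pair_energy (s k) (x k) (y k)"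
      using pair_energy_ge[of "x k" "y k" "s k"] unit ne elim(2) by fastforce
    finally show False using elim by simp
  qed
  then show False by simp
qed

text \<open>If no two equatorial limits were antipodal, the strict inequalities between the limit
  weights would persist along the sequence, and \<open>bipyramid_energy_ge\<close> would eventually
  keep the six pairs above some \<open>K > 4\<close>.\<close>

lemma bipyramid_limit_degenerate:
  fixes s :: "nat \<Rightarrow> real"
  assumes s: "\<And>k. s k > 0"
    and unit: "\<And>k. norm (p k) = 1" "\<And>k. norm (q k) = 1" "\<And>k. norm (a k) = 1"
      "\<And>k. norm (b k) = 1" "\<And>k. norm (c k) = 1"
    and dist: "\<And>k. distinct [p k, q k, a k, b k, c k]"
    and lim: "p \<longlonglongrightarrow> P" "q \<longlonglongrightarrow> - P" "a \<longlonglongrightarrow> A" "b \<longlonglongrightarrow> B" "c \<longlonglongrightarrow> C"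
    and lunit: "norm P = 1" "norm A = 1" "norm B = 1" "norm C = 1"
    and perp: "P \<bullet> A = 0" "P \<bullet> B = 0" "P \<bullet> C = 0"
    and np: "A \<bullet> B \<le> 0" "B \<bullet> C \<le> 0" "C \<bullet> A \<le> 0"
    and bdd: "\<And>K. K > 4 \<Longrightarrow> eventually (\<lambda>k.
      pair_energy (s k) (p k) (a k) + pair_energy (s k) (p k) (b k) + pair_energy (s k) (p k) (c k) +
      pair_energy (s k) (q k) (a k) + pair_energy (s k) (q k) (b k) + pair_energy (s k) (q k) (c k)
      \<le> K) sequentially"
  shows "B = - A \<or> C = - B \<or> A = - C"
proof (rule ccontr)
  assume "\<not> ?thesis"
  then obtain \<sigma> where
    pos: "0 < \<sigma> * triple P B C" "0 < \<sigma> * triple P C A" "0 < \<sigma> * triple P A B" and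
    less: "\<sigma> * triple P B C < \<sigma> * triple P C A + \<sigma> * triple P A B"
      "\<sigma> * triple P C A < \<sigma> * triple P B C + \<sigma> * triple P A B"
      "\<sigma> * triple P A B < \<sigma> * triple P B C + \<sigma> * triple P C A"
    using equator_triples[OF lunit perp np] by metis
  define W where "W = \<sigma> * triple P B C + \<sigma> * triple P C A + \<sigma> * triple P A B"
  have "max (\<sigma> * triple P B C) (max (\<sigma> * triple P C A) (\<sigma> * triple P A B)) < W / 2"
    using less by (auto simp: W_def)
  \<comment> \<open>The gap above the largest weight keeps the nearby weights below
    \<open>\<theta>\<close>; the gap below \<open>W / 2\<close> makes
    \<open>2 * W / \<theta>\<close> exceed \<open>4\<close> and leaves room for
    \<open>K\<close>.\<close>
  then obtain \<theta> where "max (\<sigma> * triple P B C) (max (\<sigma> * triple P C A) (\<sigma> * triple P A B)) < \<theta>"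
    and "\<theta> < W / 2" using dense by blast
  then have \<theta>: "\<sigma> * triple P B C < \<theta>" "\<sigma> * triple P C A < \<theta>" "\<sigma> * triple P A B < \<theta>" "4 * \<theta> < 2 * W" "0 < \<theta>"
    using pos by auto
  then have "4 < 2 * W / \<theta>" by (simp add: field_simps)
  then obtain K where K: "4 < K" "K < 2 * W / \<theta>" using dense by blast
  have K': "\<theta> * K < 2 * W" using K(2) \<theta>(5) by (simp add: field_simps)
  let ?Wk = "\<lambda>k. \<sigma> * triple (p k) (b k) (c k) + \<sigma> * triple (p k) (c k) (a k) + \<sigma> * triple (p k) (a k) (b k)"
  have t1: "(\<lambda>k. \<sigma> * triple (p k) (b k) (c k)) \<longlonglongrightarrow> \<sigma> * triple P B C"
    and t2: "(\<lambda>k. \<sigma> * triple (p k) (c k) (a k)) \<longlonglongrightarrow> \<sigma> * triple P C A"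
    and t3: "(\<lambda>k. \<sigma> * triple (p k) (a k) (b k)) \<longlonglongrightarrow> \<sigma> * triple P A B"
    by (intro tendsto_intros lim)+
  have t4: "(\<lambda>k. p k \<bullet> q k) \<longlonglongrightarrow> - 1"
    using tendsto_inner[OF lim(1,2)] lunit(1) by (simp add: norm_eq_1)
  \<comment> \<open>Antipodal poles make the first factor tend to \<open>2\<close>, the source of
    \<open>2 * W\<close>.\<close>
  have "(\<lambda>k. (1 - p k \<bullet> q k) * ?Wk k) \<longlonglongrightarrow> (1 - (- 1)) * W"
    unfolding W_def by (intro tendsto_intros t1 t2 t3 t4)
  then have "eventually (\<lambda>k. (1 - p k \<bullet> q k) * ?Wk k > \<theta> * K) sequentially"
    using K' by (intro order_tendstoD) auto
  moreover have "eventually (\<lambda>k. p k \<bullet> q k < 0) sequentially" using t4 by (rule order_tendstoD) simp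
  moreover note order_tendstoD(1)[OF t1 pos(1)] order_tendstoD(1)[OF t2 pos(2)] order_tendstoD(1)[OF t3 pos(3)]
    order_tendstoD(2)[OF t1 \<theta>(1)] order_tendstoD(2)[OF t2 \<theta>(2)] order_tendstoD(2)[OF t3 \<theta>(3)] bdd[OF K(1)]
  ultimately have "eventually (\<lambda>k. False) sequentially"
  proof eventually_elim
    case (elim k)
    note elim(1)
    also have "(1 - p k \<bullet> q k) * ?Wk k \<le> \<theta> *
      (pair_energy (s k) (p k) (a k) + pair_energy (s k) (p k) (b k) + pair_energy (s k) (p k) (c k) +
       pair_energy (s k) (q k) (a k) + pair_energy (s k) (q k) (b k) + pair_energy (s k) (q k) (c k))"
      using elim by (intro bipyramid_energy_ge unit dist s) auto
    also have "\<dots> \<le> \<theta> * K" using elim \<theta>(5) by (intro mult_left_mono) auto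
    finally show False by simp
  qed
  then show False by simp
qed

section \<open>From minimizers to the shape of the cluster point\<close>

theorem theorem7:
  fixes \<omega> :: "real \<Rightarrow> (real^3) set" and Q' :: "(real^3) set"
  assumes "\<And>s. s > 0 \<Longrightarrow> riesz_minimizing s 5 (\<omega> s)"
    and "cluster_point_at_infinity 5 \<omega> Q'"
  shows "isometric_configurations Q' {e1, - e1, e2, e3, - e3}"
proof -
  obtain s :: "nat \<Rightarrow> real" and x :: "nat \<Rightarrow> nat \<Rightarrow> real^3" and y where s: "\<And>k. s k > 0" "filterlim s at_top sequentially"
    and bij: "\<And>k. bij_betw (x k) {1..5} (\<omega> (s k))" and Q: "Q' = y ` {1..5}"
    and lim: "\<And>i. i \<in> {1..5} \<Longrightarrow> (\<lambda>k. x k i) \<longlonglongrightarrow> y i"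
    using assms(2) unfolding cluster_point_at_infinity_def by metis
  have min: "S2_configuration 5 (\<omega> (s k))" "riesz_energy (s k) (\<omega> (s k)) = min_riesz_energy (s k) 5" for k
    using assms(1) s(1) by (auto simp: riesz_minimizing_def)
  have unit: "norm (x k i) = 1" if "i \<in> {1..5}" for k i
  proof -
    have "x k i \<in> \<omega> (s k)" using bij_betwE[OF bij[of k]] that by blast
    then have "x k i \<in> S2" using min(1)[of k] unfolding S2_configuration_def by blast
    then show ?thesis by simp
  qed
  have inj: "x k i \<noteq> x k j" if "i \<in> {1..5}" "j \<in> {1..5}" "i \<noteq> j" for k i j
    using bij_betw_imp_inj_on[OF bij[of k]] that by (metis inj_onD)
  have lunit: "norm (y i) = 1" if "i \<in> {1..5}" for i
  proof -
    have "(\<lambda>k. norm (x k i)) \<longlonglongrightarrow> norm (y i)" by (intro tendsto_norm lim that)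
    then show ?thesis using unit[OF that] by (simp add: LIMSEQ_const_iff)
  qed
  \<comment> \<open>Dropping nonnegative terms from the minimal energy gives both bounds: the
    six-pair sum is used for every \<open>K > 4\<close>, the single pair only with
    \<open>K = 5\<close>.\<close>
  have energy: "eventually (\<lambda>k.
      pair_energy (s k) (x k i) (x k l) + pair_energy (s k) (x k i) (x k m) + pair_energy (s k) (x k i) (x k n) +
      pair_energy (s k) (x k j) (x k l) + pair_energy (s k) (x k j) (x k m) + pair_energy (s k) (x k j) (x k n)
      \<le> K \<and> pair_energy (s k) (x k i) (x k j) \<le> K) sequentially"
    if K: "K > 4" and ind: "distinct [i, j, l, m, n]" "{1..5} = {i, j, l, m, n}" for K i j l m n
  proof -
    have "eventually (\<lambda>k. min_riesz_energy (s k) 5 \<le> 2 * 2 powr (- s k / 2) * K) sequentially"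
      using eventually_compose_filterlim[OF min_riesz_energy_eventually_le[OF K] s(2)] .
    then show ?thesis
    proof eventually_elim
      case (elim k)
      have "\<omega> (s k) = {x k i, x k j, x k l, x k m, x k n}"
        using bij[of k] unfolding bij_betw_def ind(2) by auto
      moreover have "distinct [x k i, x k j, x k l, x k m, x k n]" using ind inj[of _ _ k] by auto
      moreover have "norm (x k i) = 1" "norm (x k j) = 1" "norm (x k l) = 1" "norm (x k m) = 1" "norm (x k n) = 1"
        using ind unit by auto
      ultimately have "2 * 2 powr (- s k / 2) *
          (pair_energy (s k) (x k i) (x k l) + pair_energy (s k) (x k i) (x k m) + pair_energy (s k) (x k i) (x k n) +
           pair_energy (s k) (x k j) (x k l) + pair_energy (s k) (x k j) (x k m) + pair_energy (s k) (x k j) (x k n) +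
           pair_energy (s k) (x k l) (x k m) + pair_energy (s k) (x k m) (x k n) + pair_energy (s k) (x k n) (x k l) +
           pair_energy (s k) (x k i) (x k j)) \<le> 2 * 2 powr (- s k / 2) * K"
        using elim min(2)[of k] riesz_energy_five[of "x k i" "x k j" "x k l" "x k m" "x k n" "s k"] by simp
      then have "pair_energy (s k) (x k i) (x k l) + pair_energy (s k) (x k i) (x k m) + pair_energy (s k) (x k i) (x k n) +
           pair_energy (s k) (x k j) (x k l) + pair_energy (s k) (x k j) (x k m) + pair_energy (s k) (x k j) (x k n) +
           pair_energy (s k) (x k l) (x k m) + pair_energy (s k) (x k m) (x k n) + pair_energy (s k) (x k n) (x k l) +
           pair_energy (s k) (x k i) (x k j) \<le> K"
        by (rule mult_left_le_imp_le) simp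
      moreover have nonneg: "0 \<le> pair_energy (s k) (x k u) (x k v)" for u v
        by (rule pair_energy_nonneg)
      ultimately show ?case
        using nonneg[of i l] nonneg[of i m] nonneg[of i n] nonneg[of j l] nonneg[of j m] nonneg[of j n]
          nonneg[of l m] nonneg[of m n] nonneg[of n l] nonneg[of i j] by linarith
    qed
  qed
  have complement: "\<exists>l m n. distinct [i, j, l, m, n] \<and> {1..5} = {i, j, l, m, n}"
    if "i \<in> {1..5}" "j \<in> {1..5}" "i \<noteq> j" for i j :: nat
  proof -
    have "card ({1..5} - {i, j}) = 3" using that by (subst card_Diff_subset) auto
    then obtain l m n where lmn: "{1..5} - {i, j} = {l, m, n}" "l \<noteq> m" "l \<noteq> n" "m \<noteq> n"
      by (auto simp: card_3_iff)
    then have "l \<notin> {i, j}" "m \<notin> {i, j}" "n \<notin> {i, j}" by blast+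
    then have "distinct [i, j, l, m, n]" using lmn that(3) by auto
    moreover have "{1..5} = {i, j} \<union> ({1..5} - {i, j})" using that by blast
    then have "{1..5} = {i, j, l, m, n}" by (simp only: lmn Un_insert_left Un_empty_left)
    ultimately show ?thesis by blast
  qed
  \<comment> \<open>In particular, the five limit points are distinct.\<close>
  have np: "y i \<bullet> y j \<le> 0" if ij: "i \<in> {1..5}" "j \<in> {1..5}" "i \<noteq> j" for i j
  proof -
    obtain l m n where ind: "distinct [i, j, l, m, n]" "{1..5} = {i, j, l, m, n}"
      using complement[OF ij] by blast
    have "eventually (\<lambda>k. pair_energy (s k) (x k i) (x k j) \<le> 5) sequentially"
      by (rule eventually_mono[OF energy[OF _ ind, of 5]]) simp_all
    then show ?thesis
      by (rule limit_inner_nonpos[OF s(2) unit[OF ij(1)] unit[OF ij(2)] inj[OF ij] lim[OF ij(1)] lim[OF ij(2)]])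
  qed
  obtain i j where ij: "i \<in> {1..5}" "j \<in> {1..5}" "i \<noteq> j" and anti: "y j = - y i"
    using exists_antipodal_pair[of y, OF lunit np] by blast
  obtain l m n where ind: "distinct [i, j, l, m, n]" "{1..5} = {i, j, l, m, n}"
    using complement[OF ij] by blast
  have mem: "l \<in> {1..5}" "m \<in> {1..5}" "n \<in> {1..5}" unfolding ind(2) by simp_all
  \<comment> \<open>Inner products with both \<open>y i\<close> and \<open>- y i\<close> are
    nonpositive, hence zero.\<close>
  have perp: "y i \<bullet> y h = 0" if "h \<in> {l, m, n}" for h
  proof -
    have "h \<in> {1..5}" "i \<noteq> h" "j \<noteq> h" using that mem ind(1) by auto
    then show ?thesis using np[OF ij(1)] np[OF ij(2)] anti by (metis antisym inner_minus_left neg_le_0_iff_le)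
  qed
  have np3: "y l \<bullet> y m \<le> 0" "y m \<bullet> y n \<le> 0" "y n \<bullet> y l \<le> 0"
    using ind(1) by (auto intro!: np mem)
  have "y m = - y l \<or> y n = - y m \<or> y l = - y n"
  proof (rule bipyramid_limit_degenerate[of s "\<lambda>k. x k i" "\<lambda>k. x k j" "\<lambda>k. x k l" "\<lambda>k. x k m" "\<lambda>k. x k n" "y i"])
    show "distinct [x k i, x k j, x k l, x k m, x k n]" for k using ind inj[of _ _ k] by auto
    show "(\<lambda>k. x k j) \<longlonglongrightarrow> - y i" using lim[OF ij(2)] anti by simp
    fix K :: real assume "K > 4"
    show "eventually (\<lambda>k.
      pair_energy (s k) (x k i) (x k l) + pair_energy (s k) (x k i) (x k m) + pair_energy (s k) (x k i) (x k n) +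
      pair_energy (s k) (x k j) (x k l) + pair_energy (s k) (x k j) (x k m) + pair_energy (s k) (x k j) (x k n)
      \<le> K) sequentially"
      by (rule eventually_mono[OF energy[OF \<open>K > 4\<close> ind]]) blast
  qed (rule s(1) unit lunit lim perp np3 ij mem | simp)+
  \<comment> \<open>Relabel the equator so that \<open>u\<close>, \<open>w\<close> carry the
    antipodal pair and \<open>v\<close> the apex of the pyramid.\<close>
  then obtain u v w where uvw: "distinct [u, v, w]" "{u, v, w} = {l, m, n}" and wu: "y w = - y u"
  proof (elim disjE)
    assume "y m = - y l" with that[of l n m] ind show ?thesis by auto
  next
    assume "y n = - y m" with that[of m l n] ind show ?thesis by auto
  next
    assume "y l = - y n" with that[of n m l] ind show ?thesis by auto
  qed
  have sub: "u \<in> {l, m, n}" "v \<in> {l, m, n}" "w \<in> {l, m, n}" using uvw(2) by blast+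
  have mem': "u \<in> {1..5}" "v \<in> {1..5}" "w \<in> {1..5}" using sub unfolding ind(2) by auto
  \<comment> \<open>The argument that put the equator orthogonal to the poles now applies to the
    pair \<open>y u\<close>, \<open>y w\<close>; thus \<open>y i\<close>, \<open>y u\<close>,
    \<open>y v\<close> are orthonormal.\<close>
  have "y u \<bullet> y v = 0" using np[OF mem'(1,2)] np[OF mem'(3,2)] uvw(1) wu by auto
  then have "isometric_configurations {y i, - y i, y u, - y u, y v} {e1, - e1, e2, e3, - e3}"
    using mem' sub ij(1) by (intro isometric_pyramid lunit perp)
  moreover have "{1..5} = {i, j, u, w, v}" using ind(2) uvw(2) by blast
  then have "Q' = {y i, - y i, y u, - y u, y v}" using Q anti wu by simp
  ultimately show ?thesis by simp
qed

end
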